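(* Let $m>0$, $g<0$, let $n\ge 1$ be an integer, and let $$V(q)=-\frac{m}{|q|}-g\sum_{k=0}^{n}\frac{C_k}{2^{2k}}\,q_1^{2n-2k}q_2^{2k},\qquad q\in\mathbb{R}^2\setminus\{0\},$$ where $C_0=1$ and $C_k=(-1)^k-\sum_{\ell=0}^{k-1}(-1)^{k-\ell}\binom{2n-2\ell}{k-\ell}C_\ell$ for $1\le k\le n$. Then for every negative energy $-f$ (i.e. every $f>0$), the energy hypersurface $\{H=-f\}$ of $H(p,q)=\frac{|p|^2}{2}+V(q)$, after Levi-Civita regularization, i.e. the hypersurface $\{K=m\}$, bounds a convex toric domain.
   Context: Levi-Civita regularization: identify $\mathbb{R}^2\cong\mathbb{C}$. The shifted Hamiltonian $H+f$ and its zero level are pulled back by the map $(z,w)\mapsto (q=z^2,\ p=\frac{w}{2\bar z})$ and multiplied by $|z|^2$ (a time reparametrization). With $z=z_1+iz_2$, $w=w_1+iw_2$, the energy level $\{H=-f\}$ becomes the level $\{K=m\}$ in $\mathbb{R}^4$ (extended smoothly over $z=0$), where $$K=\frac{|w|^2}{8}+f(z_1^2+z_2^2)-g(z_1^{4n+2}+z_2^{4n+2})=K_1(z_1,w_1)+K_2(z_2,w_2),\qquad K_i=\frac{w_i^2}{8}+f z_i^2-g z_i^{4n+2} .$$ Action variables: for $a,b\ge 0$ with $a+b=m$, let $I_1(a)=\frac{1}{2\pi}\int_{\{K_1=a\}}w_1\,dz_1$ and $I_2(b)=\frac{1}{2\pi}\int_{\{K_2=b\}}w_2\,dz_2$ be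 $\frac1{2\pi}$ times the areas enclosed by the closed curves $\{K_1=a\}$ and $\{K_2=b\}$ in the $(z_1,w_1)$- and $(z_2,w_2)$-planes (with $I_i(0)=0$). The moment map image of $\{K=m\}$ is the curve $\{(I_1(a),I_2(m-a)):0\le a\le m\}$ in the quadrant $\{I_1\ge 0, I_2\ge 0\}$, connecting the two axes. The hypersurface is said to bound a concave toric domain if this curve is the graph $I_2=\varphi(I_1)$ of a smooth non-increasing convex function $\varphi$, and a convex toric domain if it is the graph of a smooth non-increasing concave function. *)

theory Defs
  imports "HOL-Analysis.Analysis"
begin

text \<open>
  \<open>smooth_on S F\<close>: \<open>F\<close> is infinitely differentiable on \<open>S\<close>. In a witness \<open>D\<close>, \<open>D [v\<^sub>k, \<dots>, v\<^sub>1]\<close> is the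
  iterated directional derivative of \<open>F\<close>, first along \<open>v\<^sub>1\<close>, last along \<open>v\<^sub>k\<close>. Derivatives are taken
  within \<open>S\<close>, so on a compact interval they are one-sided at the end points.
\<close>

definition smooth_on :: "'a set \<Rightarrow> ('a::euclidean_space \<Rightarrow> real) \<Rightarrow> bool" where
  "smooth_on S F \<longleftrightarrow>
     (\<exists>D :: 'a list \<Rightarrow> 'a \<Rightarrow> real. D [] = F \<and>
        (\<forall>vs. \<forall>x\<in>S. (D vs has_derivative (\<lambda>v. D (v # vs) x)) (at x within S)))"

fun pot_coeff :: "nat \<Rightarrow> nat \<Rightarrow> real" where
  "pot_coeff n k =
     (if k = 0 then 1
      else (-1) ^ k - (\<Sum>l<k. (-1) ^ (k - l) * real ((2 * n - 2 * l) choose (k - l)) * pot_coeff n l))"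

declare pot_coeff.simps [simp del]

text \<open>The plane is identified with \<open>complex\<close>. Values at \<open>q = 0\<close> are junk and never used.\<close>

definition V :: "real \<Rightarrow> real \<Rightarrow> nat \<Rightarrow> complex \<Rightarrow> real" where
  "V m g n q =
     - m / norm q
     - g * (\<Sum>k\<le>n. pot_coeff n k / 2 ^ (2 * k) * Re q ^ (2 * n - 2 * k) * Im q ^ (2 * k))"

definition H :: "real \<Rightarrow> real \<Rightarrow> nat \<Rightarrow> complex \<Rightarrow> complex \<Rightarrow> real" where
  "H m g n p q = (norm p)\<^sup>2 / 2 + V m g n q"

text \<open>
  \<open>F\<close> is the Levi-Civita regularization of \<open>E(p, q)\<close>: the pullback of \<open>E\<close> along
  \<open>(z, w) \<mapsto> (q, p) = (z\<^sup>2, w / (2 cnj z))\<close>, multiplied by \<open>|z|\<^sup>2\<close>, and extended smoothly over \<open>z = 0\<close>.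
  By continuity there is at most one such \<open>F\<close>.
\<close>

definition levi_civita_regularization ::
    "(complex \<Rightarrow> complex \<Rightarrow> real) \<Rightarrow> (complex \<times> complex \<Rightarrow> real) \<Rightarrow> bool" where
  "levi_civita_regularization E F \<longleftrightarrow>
     smooth_on UNIV F \<and>
     (\<forall>z w. z \<noteq> 0 \<longrightarrow> F (z, w) = (norm z)\<^sup>2 * E (w / (2 * cnj z)) (z\<^sup>2))"

definition K :: "real \<Rightarrow> real \<Rightarrow> nat \<Rightarrow> complex \<times> complex \<Rightarrow> real" where
  "K f g n = (\<lambda>(z, w). (norm w)\<^sup>2 / 8 + f * ((Re z)\<^sup>2 + (Im z)\<^sup>2)
                       - g * (Re z ^ (4 * n + 2) + Im z ^ (4 * n + 2)))"

text \<open>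
  The two summands of \<open>K\<close> are the same function \<open>K_summand\<close>, applied to \<open>(z\<^sub>1, w\<^sub>1)\<close> and to
  \<open>(z\<^sub>2, w\<^sub>2)\<close>; hence \<open>I\<^sub>1\<close> and \<open>I\<^sub>2\<close> are the same function \<open>action\<close>.
\<close>

definition K_summand :: "real \<Rightarrow> real \<Rightarrow> nat \<Rightarrow> real \<times> real \<Rightarrow> real" where
  "K_summand f g n = (\<lambda>(x, y). y\<^sup>2 / 8 + f * x\<^sup>2 - g * x ^ (4 * n + 2))"

text \<open>
  \<open>inside C\<close> is the union of the bounded components of the complement of \<open>C\<close>, i.e. the region
  enclosed by a closed curve \<open>C\<close>; it is empty if \<open>C\<close> is a point, so that \<open>action f g n 0 = 0\<close>
  in the case \<open>f > 0\<close>, \<open>g < 0\<close>.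
\<close>

definition action :: "real \<Rightarrow> real \<Rightarrow> nat \<Rightarrow> real \<Rightarrow> real" where
  "action f g n a = measure lborel (inside {x. K_summand f g n x = a}) / (2 * pi)"

definition moment_map :: "real \<Rightarrow> real \<Rightarrow> nat \<Rightarrow> complex \<times> complex \<Rightarrow> real \<times> real" where
  "moment_map f g n = (\<lambda>(z, w). (action f g n (K_summand f g n (Re z, Re w)),
                                  action f g n (K_summand f g n (Im z, Im w))))"

text \<open>
  The moment image of \<open>S\<close> is a curve from the vertical to the horizontal axis, and the graph of a
  smooth non-increasing concave function.
\<close>

definition bounds_convex_toric_domain ::
    "('a \<Rightarrow> real \<times> real) \<Rightarrow> 'a set \<Rightarrow> bool" where
  "bounds_convex_toric_domain \<mu> S \<longleftrightarrow>
     (\<exists>A>0. \<exists>\<phi> :: real \<Rightarrow> real.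
        smooth_on {0..A} \<phi> \<and> antimono_on {0..A} \<phi> \<and> concave_on {0..A} \<phi> \<and> \<phi> A = 0 \<and>
        \<mu> ` S = {(x, \<phi> x) | x. x \<in> {0..A}})"

end

theory Submission
  imports Defs
begin

text \<open>
  Put \<open>x = z\<^sub>1\<^sup>2\<close> and \<open>y = z\<^sub>2\<^sup>2\<close>. Pulling back the potential by \<open>q = z\<^sup>2\<close> gives \<open>Re q = x - y\<close> and
  \<open>(Im q)\<^sup>2 = 4xy\<close>, so the regularized energy is \<open>K - m\<close> as soon as
  \<open>(x + y) * (\<Sum>k\<le>n. C\<^sub>k (x - y)\<^bsup>2n-2k\<^esup> (xy)\<^sup>k) = x\<^bsup>2n+1\<^esup> + y\<^bsup>2n+1\<^esup>\<close>. Dividing by \<open>x + y\<close> leaves the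
  alternating sum of the monomials of degree \<open>2n\<close>, and the recursion for \<open>C\<^sub>k\<close> is the comparison
  of coefficients of \<open>x\<^bsup>2n-k\<^esup> y\<^sup>k\<close> (lemma \<open>sum_pot_coeff\<close>).

  Both coordinates of the moment map are values of one action function \<open>I\<close>, taken at \<open>a\<close> and at
  \<open>m - a\<close>, so the moment image is the graph of \<open>\<phi> = I \<circ> (\<lambda>b. m - b) \<circ> I\<^sup>-\<^sup>1\<close>. If \<open>I\<close> is increasing and
  concave, then \<open>I\<^sup>-\<^sup>1\<close> is convex and \<open>\<phi>\<close> is concave and decreasing. Everything therefore rests on
  smoothness and concavity of \<open>I\<close>.

  Let \<open>\<Lambda>\<close> be the inverse of \<open>P v = f v - g v\<^bsup>2n+1\<^esup>\<close>. The region enclosed by a level curve of the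
  summand of \<open>K\<close> is \<open>{(x, y). x\<^sup>2 < \<Lambda> (a - y\<^sup>2/8)}\<close>. Writing \<open>\<Lambda> u = u * (\<eta> u)\<^sup>2\<close>, slicing it
  horizontally and rescaling the height by \<open>sqrt (8a)\<close> gives, up to a constant factor,
  \<open>I a = a * integral {-1..1} (\<lambda>t. sqrt (1 - t\<^sup>2) * \<eta> (a (1 - t\<^sup>2)))\<close>.

  Two things can be read off from this formula. Since \<open>\<eta>\<close> is smooth on the whole line, the formula
  defines a smooth odd function of all real \<open>a\<close>; its derivative is positive and it is unbounded, so
  it is a diffeomorphism of the line, and \<open>\<phi>\<close> is smooth beyond both end points of its interval
  although the level curves degenerate there. And \<open>a * \<eta> (a c)\<close> is a rescaling of
  \<open>u * \<eta> u = sqrt (u * \<Lambda> u)\<close>, the geometric mean of two concave functions, hence concave: here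
  the sign of \<open>g\<close> enters, since it makes \<open>P\<close> convex and so \<open>\<Lambda>\<close> concave (lemma \<open>concave_on_I\<close>).
\<close>

section \<open>Smooth functions of one real variable\<close>

primrec differentiable_times :: "nat \<Rightarrow> (real \<Rightarrow> real) \<Rightarrow> bool" where
  "differentiable_times 0 F = True"
| "differentiable_times (Suc k) F =
     (\<exists>F'. (\<forall>x. (F has_real_derivative F' x) (at x)) \<and> differentiable_times k F')"

text \<open>
  Closure properties are proved for the finite orders \<open>k\<close>, where induction applies: a derivative of
  a product, composition or inverse again contains the original functions, which are known to be
  \<open>k\<close> times differentiable when order \<open>Suc k\<close> is established.
\<close>

definition smooth :: "(real \<Rightarrow> real) \<Rightarrow> bool" where
  "smooth F \<longleftrightarrow> (\<forall>k. differentiable_times k F)"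

lemma differentiable_times_SucI:
  assumes "\<And>x. (F has_real_derivative F' x) (at x)" "differentiable_times k F'"
  shows "differentiable_times (Suc k) F"
  using assms by auto

lemma differentiable_times_SucD: "differentiable_times (Suc k) F \<Longrightarrow> differentiable_times k F"
proof (induction k arbitrary: F)
  case (Suc k)
  then show ?case by (metis differentiable_times.simps(2))
qed simp

lemma differentiable_times_const: "differentiable_times k (\<lambda>x. c)"
proof (induction k arbitrary: c)
  case (Suc k)
  have "\<forall>x. ((\<lambda>x. c) has_real_derivative 0) (at x)" by simp
  with Suc[of 0] show ?case by (intro differentiable_times_SucI[where F'="\<lambda>_. 0"]) auto
qed simp

lemma differentiable_times_ident: "differentiable_times k (\<lambda>x. x)"
proof (cases k)
  case (Suc j)
  have "\<forall>x. ((\<lambda>x. x) has_real_derivative 1) (at x)" by simp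
  with differentiable_times_const[of j 1] show ?thesis
    unfolding Suc by (intro differentiable_times_SucI[where F'="\<lambda>_. 1"]) auto
qed simp

lemma differentiable_times_add:
  "differentiable_times k F \<Longrightarrow> differentiable_times k G \<Longrightarrow> differentiable_times k (\<lambda>x. F x + G x)"
proof (induction k arbitrary: F G)
  case (Suc k)
  then obtain F' G' where
    "\<And>x. (F has_real_derivative F' x) (at x)" "differentiable_times k F'"
    "\<And>x. (G has_real_derivative G' x) (at x)" "differentiable_times k G'" by auto
  with Suc.IH[of F' G'] show ?case
    by (intro differentiable_times_SucI[where F'="\<lambda>x. F' x + G' x"] DERIV_add)
qed simp

lemma differentiable_times_mult:
  "differentiable_times k F \<Longrightarrow> differentiable_times k G \<Longrightarrow> differentiable_times k (\<lambda>x. F x * G x)"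
proof (induction k arbitrary: F G)
  case (Suc k)
  then obtain F' G' where F:
    "\<And>x. (F has_real_derivative F' x) (at x)" "differentiable_times k F'" and G:
    "\<And>x. (G has_real_derivative G' x) (at x)" "differentiable_times k G'" by auto
  have "differentiable_times k (\<lambda>x. F' x * G x + G' x * F x)"
    using F(2) G(2) Suc.prems[THEN differentiable_times_SucD]
    by (intro differentiable_times_add Suc.IH)
  then show ?case by (rule differentiable_times_SucI[OF DERIV_mult[OF F(1) G(1)]])
qed simp

lemma differentiable_times_compose:
  "differentiable_times k F \<Longrightarrow> differentiable_times k G \<Longrightarrow> differentiable_times k (\<lambda>x. F (G x))"
proof (induction k arbitrary: F G)
  case (Suc k)
  then obtain F' G' where F:
    "\<And>x. (F has_real_derivative F' x) (at x)" "differentiable_times k F'" and G: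
    "\<And>x. (G has_real_derivative G' x) (at x)" "differentiable_times k G'" by auto
  have "differentiable_times k (\<lambda>x. F' (G x) * G' x)"
    by (rule differentiable_times_mult[OF Suc.IH[OF F(2) differentiable_times_SucD[OF Suc.prems(2)]] G(2)])
  then show ?case by (rule differentiable_times_SucI[OF DERIV_chain2[OF F(1) G(1)]])
qed simp

lemma differentiable_times_powr:
  assumes "\<And>x. F x > 0"
  shows "differentiable_times k F \<Longrightarrow> differentiable_times k (\<lambda>x. F x powr p)"
proof (induction k arbitrary: p)
  case (Suc k)
  then obtain F' where F:
    "\<And>x. (F has_real_derivative F' x) (at x)" "differentiable_times k F'" by auto
  have "differentiable_times k (\<lambda>x. p * F x powr (p - 1) * F' x)"
    using F(2) Suc.IH[OF differentiable_times_SucD[OF Suc.prems]]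
    by (intro differentiable_times_mult differentiable_times_const)
  moreover have "((\<lambda>x. F x powr p) has_real_derivative p * F x powr (p - 1) * F' x) (at x)" for x
    using DERIV_powr[OF F(1) assms DERIV_const[of p], of x] assms[of x]
    by (simp add: powr_diff mult_ac)
  ultimately show ?case by (rule differentiable_times_SucI[rotated])
qed simp

lemma smooth_const: "smooth (\<lambda>x. c)"
  and smooth_ident: "smooth (\<lambda>x. x)"
  by (simp_all add: smooth_def differentiable_times_const differentiable_times_ident)

lemma smooth_add: "smooth F \<Longrightarrow> smooth G \<Longrightarrow> smooth (\<lambda>x. F x + G x)"
  and smooth_mult: "smooth F \<Longrightarrow> smooth G \<Longrightarrow> smooth (\<lambda>x. F x * G x)"
  and smooth_compose: "smooth F \<Longrightarrow> smooth G \<Longrightarrow> smooth (\<lambda>x. F (G x))"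
  and smooth_powr: "(\<And>x. F x > 0) \<Longrightarrow> smooth F \<Longrightarrow> smooth (\<lambda>x. F x powr p)"
  by (simp_all add: smooth_def differentiable_times_add differentiable_times_mult
      differentiable_times_compose differentiable_times_powr)

lemma smooth_diff: "smooth F \<Longrightarrow> smooth G \<Longrightarrow> smooth (\<lambda>x. F x - G x)"
  using smooth_add[of F "\<lambda>x. (-1) * G x"] smooth_mult[OF smooth_const[of "-1"], of G] by simp

lemma smooth_power: "smooth F \<Longrightarrow> smooth (\<lambda>x. F x ^ k)"
  by (induction k) (simp_all add: smooth_const smooth_mult)

lemmas smooth_intros =
  smooth_const smooth_ident smooth_add smooth_diff smooth_mult smooth_power smooth_powr

lemma smooth_derivative:
  assumes "smooth F"
  obtains F' where "\<And>x. (F has_real_derivative F' x) (at x)" "smooth F'"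
proof -
  have "differentiable_times (Suc 0) F" using assms unfolding smooth_def by blast
  then obtain F' where F': "\<And>x. (F has_real_derivative F' x) (at x)" by auto
  have "differentiable_times k F'" for k
  proof -
    have "differentiable_times (Suc k) F" using assms unfolding smooth_def by blast
    then obtain G where G: "\<And>x. (F has_real_derivative G x) (at x)" "differentiable_times k G" by auto
    then have "G = F'" using F' DERIV_unique by blast
    then show ?thesis using G by simp
  qed
  then show ?thesis using F' that unfolding smooth_def by blast
qed

lemma smooth_DERIV_deriv: "smooth F \<Longrightarrow> (F has_real_derivative deriv F x) (at x)"
  by (metis smooth_derivative DERIV_imp_deriv)

lemma smooth_deriv: "smooth F \<Longrightarrow> smooth (deriv F)"
proof -
  assume "smooth F"
  then obtain F' where "\<And>x. (F has_real_derivative F' x) (at x)" "smooth F'"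
    using smooth_derivative by blast
  moreover from this have "F' = deriv F" by (metis DERIV_imp_deriv ext)
  ultimately show ?thesis by simp
qed

lemma smooth_continuous: "smooth F \<Longrightarrow> continuous_on S F"
  by (meson DERIV_isCont continuous_at_imp_continuous_on smooth_DERIV_deriv)

text \<open>
  The iterated directional derivative along \<open>v\<^sub>1, \<dots>, v\<^sub>k\<close> is the \<open>k\<close>-th derivative of \<open>F\<close> times the
  product of the numbers \<open>l v\<^sub>i\<close>. All smoothness in several variables reduces to this, because \<open>K\<close>
  is a sum of functions of single coordinates.
\<close>

lemma smooth_on_linear_argument:
  fixes l :: "'a::euclidean_space \<Rightarrow> real"
  assumes "smooth F" "bounded_linear l"
  shows "smooth_on S (\<lambda>x. F (l x))"
proof -
  define D where "D vs x = (deriv ^^ length vs) F (l x) * prod_list (map l vs)" for vs :: "'a list" and x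
  have sm: "smooth ((deriv ^^ k) F)" for k
    by (induction k) (simp_all add: assms(1) smooth_deriv)
  have "(D vs has_derivative (\<lambda>v. D (v # vs) x)) (at x within S)" for vs x
  proof -
    have "((deriv ^^ length vs) F has_derivative (*) (deriv ((deriv ^^ length vs) F) (l x))) (at (l x))"
      using smooth_DERIV_deriv[OF sm] by (simp add: has_field_derivative_def)
    moreover have "(l has_derivative l) (at x within S)"
      using assms(2) by (rule bounded_linear_imp_has_derivative)
    ultimately have "((\<lambda>x. (deriv ^^ length vs) F (l x)) has_derivative
        (\<lambda>v. deriv ((deriv ^^ length vs) F) (l x) * l v)) (at x within S)"
      using has_derivative_compose by blast
    then have "((\<lambda>x. (deriv ^^ length vs) F (l x) * prod_list (map l vs)) has_derivative
        (\<lambda>v. deriv ((deriv ^^ length vs) F) (l x) * l v * prod_list (map l vs))) (at x within S)"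
      by (rule has_derivative_mult_left)
    then show ?thesis by (simp add: D_def[abs_def] mult.assoc)
  qed
  moreover have "D [] = (\<lambda>x. F (l x))" by (simp add: D_def fun_eq_iff)
  ultimately show ?thesis unfolding smooth_on_def by blast
qed

lemma smooth_on_add:
  assumes "smooth_on S F" "smooth_on S G"
  shows "smooth_on S (\<lambda>x. F x + G x)"
proof -
  obtain D E where "D [] = F" "E [] = G"
    "\<forall>vs. \<forall>x\<in>S. (D vs has_derivative (\<lambda>v. D (v # vs) x)) (at x within S)"
    "\<forall>vs. \<forall>x\<in>S. (E vs has_derivative (\<lambda>v. E (v # vs) x)) (at x within S)"
    using assms unfolding smooth_on_def by blast
  then show ?thesis unfolding smooth_on_def
    by (intro exI[of _ "\<lambda>vs x. D vs x + E vs x"]) (auto intro!: has_derivative_add)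
qed

text \<open>
  Smoothness of \<open>G\<close> bootstraps: \<open>G' = 1 / (F' \<circ> G)\<close> is \<open>k\<close> times differentiable if \<open>G\<close> is.
\<close>

lemma smooth_inverse_function:
  assumes F: "smooth F" and pos: "\<And>x. deriv F x > 0" and inv: "\<And>y. F (G y) = y"
  shows "smooth G" and "strict_mono F" and "G (F x) = x" and "strict_mono G" and "deriv G y > 0"
proof -
  show F_mono: "strict_mono F"
    by (rule strict_monoI, rule DERIV_pos_imp_increasing) (use smooth_DERIV_deriv[OF F] pos in blast)+
  show GF: "G (F x) = x" for x using inv strict_mono_eq[OF F_mono] by blast
  show "strict_mono G"
    by (rule strict_monoI) (metis inv F_mono strict_mono_less)
  have cont: "isCont G y" for y
  proof -
    have "isCont G (F (G y))"
      by (rule isCont_inverse_function[where f=F and d=1])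
         (use GF DERIV_isCont[OF smooth_DERIV_deriv[OF F]] in auto)
    then show ?thesis by (simp add: inv)
  qed
  have der: "(G has_real_derivative inverse (deriv F (G y))) (at y)" for y
    by (rule DERIV_inverse_function[where f=F and a="y-1" and b="y+1"])
       (use smooth_DERIV_deriv[OF F] pos[of "G y"] inv cont in auto)
  then show "deriv G y > 0" using DERIV_imp_deriv[OF der] pos by simp
  have "differentiable_times k G" for k
  proof (induction k)
    case (Suc k)
    have "differentiable_times k (\<lambda>y. deriv F (G y) powr (-1))"
      using differentiable_times_compose[of k "deriv F", OF _ Suc] smooth_deriv[OF F] pos
      by (intro differentiable_times_powr) (auto simp: smooth_def)
    moreover have "deriv F (G y) powr (-1) = inverse (deriv F (G y))" for y
      using pos[of "G y"] by (simp add: powr_minus)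
    ultimately show ?case using der by (intro differentiable_times_SucI[where F'="\<lambda>y. inverse (deriv F (G y))"]) simp_all
  qed simp
  then show "smooth G" by (simp add: smooth_def)
qed

lemma odd_unbounded_imp_surj:
  fixes F :: "real \<Rightarrow> real"
  assumes cont: "continuous_on UNIV F" and odd: "\<And>x. F (- x) = - F x" and unb: "\<And>y. \<exists>x. F x \<ge> y"
  shows "F (inv F y) = y"
proof -
  obtain b where b: "F b \<ge> y" using unb by blast
  obtain a where "F a \<ge> -y" using unb by blast
  then have a: "F (-a) \<le> y" using odd[of a] by simp
  have "connected (range F)" using cont by (intro connected_continuous_image) auto
  then have "y \<in> range F" using a b unfolding connected_iff_interval by blast
  then show ?thesis by (rule f_inv_into_f)
qed

text \<open>
  The derivative is an integral of the same form, with weight \<open>w * c\<close> in place of \<open>w\<close> and \<open>deriv h\<close>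
  in place of \<open>h\<close>; this is what makes the induction for smoothness work.
\<close>

lemma DERIV_scaled_integral:
  fixes w c :: "real \<Rightarrow> real"
  assumes h: "smooth h" and w: "continuous_on {\<alpha>..\<beta>} w" and c: "continuous_on {\<alpha>..\<beta>} c"
  shows "((\<lambda>a. integral {\<alpha>..\<beta>} (\<lambda>t. w t * h (a * c t))) has_real_derivative
           integral {\<alpha>..\<beta>} (\<lambda>t. w t * c t * deriv h (a * c t))) (at a)"
proof -
  note [continuous_intros] = continuous_on_compose2[OF smooth_continuous[OF h, of UNIV]]
    continuous_on_compose2[OF smooth_continuous[OF smooth_deriv[OF h], of UNIV]]
    continuous_on_compose2[OF w] continuous_on_compose2[OF c]
  have "((\<lambda>a. integral (cbox \<alpha> \<beta>) (\<lambda>t. w t * h (a * c t))) has_real_derivative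
           integral (cbox \<alpha> \<beta>) (\<lambda>t. w t * c t * deriv h (a * c t))) (at a within UNIV)"
  proof (rule leibniz_rule_field_derivative)
    fix x t
    have "((\<lambda>x. h (x * c t)) has_real_derivative deriv h (x * c t) * c t) (at x)"
      by (rule DERIV_chain2[OF smooth_DERIV_deriv[OF h]]) (auto intro!: derivative_eq_intros)
    from DERIV_cmult[OF this, of "w t"]
    show "((\<lambda>x. w t * h (x * c t)) has_real_derivative w t * c t * deriv h (x * c t)) (at x within UNIV)"
      by (simp add: mult_ac)
  next
    show "continuous_on (UNIV \<times> cbox \<alpha> \<beta>) (\<lambda>(x, t). w t * c t * deriv h (x * c t))"
      unfolding split_beta by (intro continuous_intros) auto
  next
    fix x show "(\<lambda>t. w t * h (x * c t)) integrable_on cbox \<alpha> \<beta>"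
      unfolding cbox_interval by (intro integrable_continuous_real continuous_intros) auto
  qed auto
  then show ?thesis by simp
qed

lemma smooth_scaled_integral:
  fixes w c :: "real \<Rightarrow> real"
  assumes h: "smooth h" and w: "continuous_on {\<alpha>..\<beta>} w" and c: "continuous_on {\<alpha>..\<beta>} c"
  shows "smooth (\<lambda>a. integral {\<alpha>..\<beta>} (\<lambda>t. w t * h (a * c t)))"
proof -
  have "differentiable_times k (\<lambda>a. integral {\<alpha>..\<beta>} (\<lambda>t. w t * h (a * c t)))" for k
    using h w
  proof (induction k arbitrary: h w)
    case (Suc k)
    have "differentiable_times k (\<lambda>a. integral {\<alpha>..\<beta>} (\<lambda>t. w t * c t * deriv h (a * c t)))"
      using Suc.prems by (intro Suc.IH smooth_deriv continuous_on_mult c)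
    then show ?case by (rule differentiable_times_SucI[OF DERIV_scaled_integral[OF Suc.prems c]])
  qed simp
  then show ?thesis by (simp add: smooth_def)
qed

section \<open>The regularized Hamiltonian\<close>

text \<open>
  The recursion with its term for \<open>l = k\<close> moved to the other side; at \<open>k = 0\<close> it is \<open>C\<^sub>0 = 1\<close>.
\<close>

lemma pot_coeff_convolution:
  "(\<Sum>l\<le>k. (-1) ^ (k - l) * real ((2 * n - 2 * l) choose (k - l)) * pot_coeff n l) = (-1) ^ k"
proof (cases "k = 0")
  case True
  then show ?thesis by (simp add: pot_coeff.simps[of n 0])
next
  case False
  then show ?thesis
    unfolding lessThan_Suc_atMost[symmetric] by (simp add: pot_coeff.simps[of n k])
qed

text \<open>
  For \<open>j \<le> n\<close> the coefficient of \<open>x\<^bsup>2n-j\<^esup> y\<^sup>j\<close> on the left is the convolution above. For \<open>j > n\<close> it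
  equals the coefficient at \<open>2n - j\<close>: the left side is symmetric in \<open>x\<close> and \<open>y\<close>, as the powers of
  \<open>x - y\<close> are even, which on coefficients is the symmetry of the binomial coefficients.
\<close>

lemma sum_pot_coeff_alternating:
  fixes x y :: real
  shows "(\<Sum>l\<le>n. pot_coeff n l * (x - y) ^ (2 * n - 2 * l) * (x * y) ^ l) =
         (\<Sum>j\<le>2*n. (-1) ^ j * x ^ (2 * n - j) * y ^ j)"
proof -
  \<comment> \<open>the coefficient of \<open>x\<^bsup>2n-j\<^esup> y\<^sup>j\<close> in the \<open>l\<close>-th summand\<close>
  define b where "b l j = (if l \<le> j then (-1) ^ (j - l) * real ((2 * n - 2 * l) choose (j - l)) else 0)" for l j
  have expand: "(x - y) ^ (2 * n - 2 * l) * (x * y) ^ l = (\<Sum>j\<le>2*n. b l j * x ^ (2 * n - j) * y ^ j)"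
    if l: "l \<le> n" for l
  proof -
    have "(x - y) ^ (2 * n - 2 * l) =
        (\<Sum>i\<le>2*n-2*l. real ((2*n-2*l) choose i) * (- y) ^ i * x ^ (2*n-2*l-i))"
      using binomial_ring[of "-y" x "2*n-2*l"] by simp
    then have "(x - y) ^ (2 * n - 2 * l) * (x * y) ^ l =
        (\<Sum>i\<le>2*n-2*l. real ((2*n-2*l) choose i) * (- y) ^ i * x ^ (2*n-2*l-i) * (x * y) ^ l)"
      by (simp add: sum_distrib_right)
    also have "\<dots> = (\<Sum>i\<le>2*n-2*l. b l (i + l) * x ^ (2*n-(i+l)) * y ^ (i+l))"
    proof (rule sum.cong[OF refl])
      fix i assume "i \<in> {..2*n-2*l}"
      then have "2*n-(i+l) = (2*n-2*l-i) + l" using l by auto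
      then show "real ((2*n-2*l) choose i) * (- y) ^ i * x ^ (2*n-2*l-i) * (x * y) ^ l =
          b l (i + l) * x ^ (2*n-(i+l)) * y ^ (i+l)"
        by (simp add: b_def power_add power_mult_distrib power_minus[of y])
    qed
    also have "\<dots> = (\<Sum>j\<in>{l..2*n-l}. b l j * x ^ (2*n-j) * y ^ j)"
      by (rule sum.reindex_bij_witness[of _ "\<lambda>j. j - l" "\<lambda>i. i + l"]) (use l in auto)
    also have "\<dots> = (\<Sum>j\<le>2*n. b l j * x ^ (2*n-j) * y ^ j)"
      by (rule sum.mono_neutral_left) (use l in \<open>auto simp: b_def\<close>)
    finally show ?thesis .
  qed
  have coefficient: "(\<Sum>l\<le>n. pot_coeff n l * b l j) = (-1) ^ j" if j: "j \<le> 2 * n" for j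
  proof (cases "j \<le> n")
    case True
    have "(\<Sum>l\<le>n. pot_coeff n l * b l j) = (\<Sum>l\<le>j. pot_coeff n l * b l j)"
      by (rule sum.mono_neutral_right) (use True in \<open>auto simp: b_def\<close>)
    also have "\<dots> = (-1) ^ j"
      unfolding pot_coeff_convolution[of j n, symmetric] by (rule sum.cong) (auto simp: b_def)
    finally show ?thesis .
  next
    case False
    define i where "i = 2 * n - j"
    have i: "i < n" "j = 2 * n - i" using False j by (auto simp: i_def)
    have sym: "b l j = b l i" if "l \<le> n" for l
    proof (cases "l \<le> i")
      case True
      have "j - l = 2*n-2*l - (i - l)" "i - l \<le> 2*n-2*l" using True i by auto
      then have "(2*n-2*l) choose (j - l) = (2*n-2*l) choose (i - l)"
        using binomial_symmetric by metis
      moreover have "even (j - l) = even (i - l)" using True i that by auto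
      then have "(-1::real) ^ (j - l) = (-1) ^ (i - l)" by (simp add: minus_one_power_iff)
      ultimately show ?thesis using True i that by (simp add: b_def)
    next
      case False
      then have "2*n-2*l < j - l" using i that by auto
      then show ?thesis using False by (simp add: b_def)
    qed
    have "(\<Sum>l\<le>n. pot_coeff n l * b l j) = (\<Sum>l\<le>n. pot_coeff n l * b l i)"
      by (rule sum.cong) (simp_all add: sym)
    also have "\<dots> = (\<Sum>l\<le>i. pot_coeff n l * b l i)"
      by (rule sum.mono_neutral_right) (use i in \<open>auto simp: b_def\<close>)
    also have "\<dots> = (-1) ^ i"
      unfolding pot_coeff_convolution[of i n, symmetric] by (rule sum.cong) (auto simp: b_def)
    also have "\<dots> = (-1) ^ j" using i by (simp add: minus_one_power_iff)
    finally show ?thesis .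
  qed
  have "(\<Sum>l\<le>n. pot_coeff n l * (x - y) ^ (2 * n - 2 * l) * (x * y) ^ l) =
      (\<Sum>l\<le>n. \<Sum>j\<le>2*n. pot_coeff n l * b l j * (x ^ (2 * n - j) * y ^ j))"
    by (rule sum.cong) (simp_all add: mult.assoc expand sum_distrib_left)
  also have "\<dots> = (\<Sum>j\<le>2*n. (\<Sum>l\<le>n. pot_coeff n l * b l j) * (x ^ (2 * n - j) * y ^ j))"
    by (subst sum.swap) (simp add: sum_distrib_right)
  also have "\<dots> = (\<Sum>j\<le>2*n. (-1) ^ j * x ^ (2 * n - j) * y ^ j)"
    by (rule sum.cong) (simp_all add: coefficient mult.assoc)
  finally show ?thesis .
qed

lemma sum_pot_coeff:
  fixes x y :: real
  shows "(x + y) * (\<Sum>l\<le>n. pot_coeff n l * (x - y) ^ (2 * n - 2 * l) * (x * y) ^ l) =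
         x ^ (2 * n + 1) + y ^ (2 * n + 1)"
proof -
  have "x ^ Suc (2 * n) - (- y) ^ Suc (2 * n) =
      (x - (- y)) * (\<Sum>j<Suc (2 * n). (- y) ^ (2 * n - j) * x ^ j)"
    using diff_power_eq_sum[of x "2 * n" "-y"] by (simp add: mult.commute)
  also have "(\<Sum>j<Suc (2 * n). (- y) ^ (2 * n - j) * x ^ j) = (\<Sum>j\<le>2*n. (-1) ^ j * x ^ (2 * n - j) * y ^ j)"
    unfolding lessThan_Suc_atMost
    by (rule sum.reindex_bij_witness[of _ "\<lambda>j. 2*n-j" "\<lambda>j. 2*n-j"]) (auto simp: power_minus[of y])
  finally show ?thesis unfolding sum_pot_coeff_alternating by simp
qed

lemma smooth_on_K: "smooth_on UNIV (\<lambda>p. K f g n p - m)"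
proof -
  let ?V = "\<lambda>x::real. f * x ^ 2 - g * x ^ (4 * n + 2)" and ?T = "\<lambda>y::real. (1/8) * y ^ 2"
  have "smooth_on UNIV (\<lambda>p::complex \<times> complex.
      ((?T (Re (snd p)) + ?T (Im (snd p))) + ?V (Re (fst p))) + (?V (Im (fst p)) - m))"
    by (intro smooth_on_add smooth_on_linear_argument[where F="?T"] smooth_on_linear_argument[where F="?V"]
       smooth_on_linear_argument[where F="\<lambda>x. ?V x - m"] smooth_intros
       bounded_linear_compose[OF bounded_linear_Re] bounded_linear_compose[OF bounded_linear_Im]
       bounded_linear_fst bounded_linear_snd)
  moreover have "(\<lambda>p. K f g n p - m) = (\<lambda>p::complex \<times> complex.
      ((?T (Re (snd p)) + ?T (Im (snd p))) + ?V (Re (fst p))) + (?V (Im (fst p)) - m))"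
    by (auto simp: K_def fun_eq_iff cmod_power2 algebra_simps)
  ultimately show ?thesis by simp
qed

lemma levi_civita_regularization_H:
  "levi_civita_regularization (\<lambda>p q. H m g n p q + f) (\<lambda>x. K f g n x - m)"
proof -
  have "K f g n (z, w) - m = (norm z)\<^sup>2 * (H m g n (w / (2 * cnj z)) (z\<^sup>2) + f)" if "z \<noteq> 0" for z w
  proof -
    let ?x = "(Re z)\<^sup>2" and ?y = "(Im z)\<^sup>2"
    have nz: "norm z > 0" using that by simp
    have potential: "(\<Sum>k\<le>n. pot_coeff n k / 2 ^ (2 * k) * Re (z\<^sup>2) ^ (2 * n - 2 * k) * Im (z\<^sup>2) ^ (2 * k))
        = (\<Sum>k\<le>n. pot_coeff n k * (?x - ?y) ^ (2 * n - 2 * k) * (?x * ?y) ^ k)"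
    proof (rule sum.cong[OF refl])
      fix k
      have "Im (z\<^sup>2) ^ (2 * k) = 2 ^ (2 * k) * (?x * ?y) ^ k"
        by (simp add: Im_power2 power_mult_distrib power_mult[symmetric])
      then show "pot_coeff n k / 2 ^ (2 * k) * Re (z\<^sup>2) ^ (2 * n - 2 * k) * Im (z\<^sup>2) ^ (2 * k)
          = pot_coeff n k * (?x - ?y) ^ (2 * n - 2 * k) * (?x * ?y) ^ k"
        by (simp add: Re_power2)
    qed
    have "(norm z)\<^sup>2 * (\<Sum>k\<le>n. pot_coeff n k / 2 ^ (2 * k) * Re (z\<^sup>2) ^ (2 * n - 2 * k) * Im (z\<^sup>2) ^ (2 * k))
        = ?x ^ (2 * n + 1) + ?y ^ (2 * n + 1)"
      unfolding potential cmod_power2 by (rule sum_pot_coeff)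
    also have "\<dots> = Re z ^ (4 * n + 2) + Im z ^ (4 * n + 2)"
      by (simp only: power_mult[symmetric]) (simp add: algebra_simps)
    finally have 1: "(norm z)\<^sup>2 * (g * (\<Sum>k\<le>n. pot_coeff n k / 2 ^ (2 * k) * Re (z\<^sup>2) ^ (2 * n - 2 * k) * Im (z\<^sup>2) ^ (2 * k)))
        = g * (Re z ^ (4 * n + 2) + Im z ^ (4 * n + 2))" by (simp add: mult.left_commute)
    have 2: "(norm z)\<^sup>2 * ((norm (w / (2 * cnj z)))\<^sup>2 / 2) = (norm w)\<^sup>2 / 8"
      using nz by (simp add: norm_divide norm_mult power_divide power_mult_distrib)
    have 3: "(norm z)\<^sup>2 * (m / norm (z\<^sup>2)) = m" using nz by (simp add: norm_power)
    show ?thesis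
      unfolding H_def V_def K_def prod.case distrib_left right_diff_distrib 1 2 
      using 3 by (simp add: cmod_power2 algebra_simps)
  qed
  then show ?thesis unfolding levi_civita_regularization_def using smooth_on_K by blast
qed

section \<open>The region enclosed by a level curve\<close>

lemma convex_on_K_summand:
  assumes "f > 0" "g < 0"
  shows "convex_on UNIV (K_summand f g n)"
proof -
  have convex_linear: "convex_on UNIV (\<lambda>p::real \<times> real. h (l p))" if "convex_on UNIV h" "linear l" for h :: "real \<Rightarrow> real" and l
    using that by (auto simp: convex_on_def linear_add linear_scale)
  have "convex_on UNIV (\<lambda>p::real \<times> real. (1/8) * snd p ^ 2 + f * fst p ^ 2 + (- g) * fst p ^ (4 * n + 2))"
  proof (intro convex_on_add)
    show "convex_on UNIV (\<lambda>p::real \<times> real. (1/8) * snd p ^ 2)"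
      by (rule convex_on_cmul[OF _ convex_linear[OF convex_power2 linear_snd]]) simp
    show "convex_on UNIV (\<lambda>p::real \<times> real. f * fst p ^ 2)"
      using assms by (intro convex_on_cmul[OF _ convex_linear[OF convex_power2 linear_fst]]) simp
    show "convex_on UNIV (\<lambda>p::real \<times> real. (- g) * fst p ^ (4 * n + 2))"
      using assms by (intro convex_on_cmul[OF _ convex_linear[OF convex_power_even linear_fst]]) simp_all
  qed
  moreover have "(\<lambda>p::real \<times> real. (1/8) * snd p ^ 2 + f * fst p ^ 2 + (- g) * fst p ^ (4 * n + 2)) = K_summand f g n"
    by (auto simp: K_summand_def fun_eq_iff)
  ultimately show ?thesis by simp
qed

lemma continuous_on_K_summand: "continuous_on S (K_summand f g n)"
  unfolding K_summand_def split_beta by (intro continuous_intros) auto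

lemma K_summand_nonneg:
  assumes "f > 0" "g < 0"
  shows "K_summand f g n p \<ge> 0"
proof -
  have "g * fst p ^ (4 * n + 2) \<le> 0"
    using assms by (intro mult_nonpos_nonneg zero_le_even_power) auto
  moreover have "f * (fst p)\<^sup>2 \<ge> 0" "(snd p)\<^sup>2 / 8 \<ge> 0" using assms by auto
  ultimately show ?thesis unfolding K_summand_def split_beta by linarith
qed

text \<open>
  The closed sublevel set is convex and bounded, so its frontier encloses its interior. The frontier is
  the level curve because moving a point away from the axis \<open>y = 0\<close> strictly increases the function;
  for \<open>a = 0\<close> this argument still applies and gives the empty region.
\<close>

lemma inside_K_summand_level:
  assumes "f > 0" "g < 0"
  shows "inside {p. K_summand f g n p = a} = {p. K_summand f g n p < a}"
proof -
  define S where "S = {p. K_summand f g n p \<le> a}"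
  have "convex S"
    unfolding S_def convex_def
  proof (intro ballI allI impI, unfold mem_Collect_eq)
    fix p q :: "real \<times> real" and u v :: real
    assume *: "K_summand f g n p \<le> a" "K_summand f g n q \<le> a" "0 \<le> u" "0 \<le> v" "u + v = 1"
    have "K_summand f g n (u *\<^sub>R p + v *\<^sub>R q) \<le> u * K_summand f g n p + v * K_summand f g n q"
      using convex_on_K_summand[OF assms, of n] * unfolding convex_on_def by blast
    also have "\<dots> \<le> a" using * by (intro convex_bound_le)
    finally show "K_summand f g n (u *\<^sub>R p + v *\<^sub>R q) \<le> a" .
  qed
  have "S \<subseteq> {-sqrt (a/f)..sqrt (a/f)} \<times> {-sqrt (8*a)..sqrt (8*a)}"
  proof
    fix p assume "p \<in> S"
    then obtain x y where p: "p = (x, y)" and a: "y\<^sup>2 / 8 + f * x\<^sup>2 - g * x ^ (4 * n + 2) \<le> a"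
      by (cases p) (auto simp: S_def K_summand_def)
    have "g * x ^ (4 * n + 2) \<le> 0"
      using assms by (intro mult_nonpos_nonneg zero_le_even_power) auto
    then have "y\<^sup>2 / 8 + f * x\<^sup>2 \<le> a" using a by simp
    then have "f * x\<^sup>2 \<le> a" "y\<^sup>2 / 8 \<le> a"
      using mult_nonneg_nonneg[OF less_imp_le[OF assms(1)] zero_le_power2[of x]] zero_le_power2[of y]
      by linarith+
    then have "x\<^sup>2 \<le> a / f" "y\<^sup>2 \<le> 8 * a" using assms by (simp_all add: field_simps)
    then have "\<bar>x\<bar> \<le> sqrt (a/f)" "\<bar>y\<bar> \<le> sqrt (8*a)"
      using real_le_rsqrt real_sqrt_abs real_sqrt_le_iff by metis+
    then show "p \<in> {-sqrt (a/f)..sqrt (a/f)} \<times> {-sqrt (8*a)..sqrt (8*a)}" by (auto simp: p)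
  qed
  then have "bounded S" by (rule bounded_subset[rotated]) (intro bounded_Times bounded_closed_interval)
  have interior: "interior S = {p. K_summand f g n p < a}"
  proof (intro antisym subsetI)
    fix p assume p: "p \<in> interior S"
    then obtain e where e: "e > 0" "ball p e \<subseteq> S" using mem_interior by blast
    obtain x y where xy: "p = (x, y)" by (cases p)
    \<comment> \<open>a point of \<open>S\<close> further from the axis than \<open>p\<close>\<close>
    define y' where "y' = (if y \<ge> 0 then y + e/2 else y - e/2)"
    have "(x, y') \<in> S" using e by (auto simp: xy y'_def dist_Pair_Pair dist_real_def subset_iff)
    moreover have "y\<^sup>2 < y'\<^sup>2"
      using e(1) by (intro power2_strict_mono) (auto simp: y'_def)
    ultimately show "p \<in> {p. K_summand f g n p < a}"
      by (auto simp: S_def K_summand_def xy)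
  next
    fix p assume "p \<in> {p. K_summand f g n p < a}"
    moreover have "open {p. K_summand f g n p < a}"
      by (intro open_Collect_less continuous_on_K_summand continuous_intros)
    moreover have "{p. K_summand f g n p < a} \<subseteq> S" by (auto simp: S_def)
    ultimately show "p \<in> interior S" by (metis interior_maximal subsetD)
  qed
  have "closed S" unfolding S_def by (intro closed_Collect_le continuous_on_K_summand continuous_intros)
  then have "frontier S = S - interior S" by (simp add: frontier_def)
  also have "\<dots> = {p. K_summand f g n p = a}" unfolding interior by (auto simp: S_def)
  finally show ?thesis
    using inside_frontier_eq_interior[OF \<open>bounded S\<close> \<open>convex S\<close>] interior by simp
qed

section \<open>Concavity and positivity lemmas\<close>

lemma concave_on_inverse_function:
  fixes F G :: "real \<Rightarrow> real"
  assumes "convex_on A F" "strict_mono F" "\<And>y. F (G y) = y" "\<And>y. y \<in> B \<Longrightarrow> G y \<in> A" "convex B"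
  shows "concave_on B G"
  unfolding concave_on_iff
proof (intro conjI ballI allI impI)
  fix x y u v :: real assume *: "x \<in> B" "y \<in> B" "0 \<le> u" "0 \<le> v" "u + v = 1"
  have "F (u * G x + v * G y) \<le> u * F (G x) + v * F (G y)"
    using assms(1,4) * unfolding convex_on_def by (metis real_scaleR_def)
  also have "\<dots> = F (G (u * x + v * y))" by (simp add: assms(3))
  finally show "u * G x + v * G y \<le> G (u *\<^sub>R x + v *\<^sub>R y)"
    using strict_mono_less_eq[OF assms(2)] by simp
qed fact

text \<open>
  The geometric mean is increasing in both arguments, and it is concave by the inequality of Cauchy and
  Schwarz for two summands.
\<close>

lemma concave_on_sqrt_mult:
  fixes F G :: "real \<Rightarrow> real"
  assumes F: "concave_on A F" and G: "concave_on A G"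
    and nonneg: "\<And>x. x \<in> A \<Longrightarrow> F x \<ge> 0" "\<And>x. x \<in> A \<Longrightarrow> G x \<ge> 0"
  shows "concave_on A (\<lambda>x. sqrt (F x * G x))"
  unfolding concave_on_iff
proof (intro conjI ballI allI impI)
  fix x y u v :: real assume *: "x \<in> A" "y \<in> A" "0 \<le> u" "0 \<le> v" "u + v = 1"
  have nn: "F x \<ge> 0" "F y \<ge> 0" "G x \<ge> 0" "G y \<ge> 0" using nonneg * by auto
  have "(u * sqrt (F x * G x) + v * sqrt (F y * G y))\<^sup>2 \<le> (u * F x + v * F y) * (u * G x + v * G y)"
  proof -
    have "0 \<le> u * v * (sqrt (F x * G y) - sqrt (F y * G x))\<^sup>2" using * by simp
    also have "\<dots> = (u * F x + v * F y) * (u * G x + v * G y) - (u * sqrt (F x * G x) + v * sqrt (F y * G y))\<^sup>2"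
      using nn by (simp add: power2_eq_square algebra_simps real_sqrt_mult)
    finally show ?thesis by simp
  qed
  also have "\<dots> \<le> F (u *\<^sub>R x + v *\<^sub>R y) * G (u *\<^sub>R x + v *\<^sub>R y)"
    using F G * nn unfolding concave_on_iff
    by (intro mult_mono) (auto intro: order_trans[of 0 "u * F x + v * F y"])
  finally show "u * sqrt (F x * G x) + v * sqrt (F y * G y) \<le> sqrt (F (u *\<^sub>R x + v *\<^sub>R y) * G (u *\<^sub>R x + v *\<^sub>R y))"
    by (rule real_le_rsqrt)
qed (use F in \<open>simp add: concave_on_iff\<close>)

lemma integral_pos_continuous:
  fixes F :: "real \<Rightarrow> real"
  assumes cont: "continuous_on {\<alpha>..\<beta>} F" and "\<alpha> < \<beta>"
    and nonneg: "\<And>t. t \<in> {\<alpha>..\<beta>} \<Longrightarrow> F t \<ge> 0" and "t \<in> {\<alpha>..\<beta>}" "F t \<noteq> 0"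
  shows "integral {\<alpha>..\<beta>} F > 0"
proof -
  have "F integrable_on {\<alpha>..\<beta>}" using cont by (rule integrable_continuous_real)
  then have I: "(F has_integral integral {\<alpha>..\<beta>} F) (cbox \<alpha> \<beta>)" by (simp add: has_integral_integral)
  have "integral {\<alpha>..\<beta>} F \<ge> 0" by (rule integral_nonneg) (fact \<open>F integrable_on {\<alpha>..\<beta>}\<close>, rule nonneg)
  moreover have "integral {\<alpha>..\<beta>} F \<noteq> 0"
    using has_integral_0_cbox_imp_0[of \<alpha> \<beta> F t] I assms by (auto simp: cbox_interval)
  ultimately show ?thesis by simp
qed

section \<open>The action function\<close>

locale decoupled_oscillator =
  fixes f g :: real and n :: nat
  assumes f_pos: "f > 0" and g_neg: "g < 0"
begin

text \<open>
  \<open>P (x\<^sup>2)\<close> is the potential of one summand of \<open>K\<close>, so \<open>\<Lambda> u\<close> is the square of the turning point at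
  energy \<open>u\<close>. Since \<open>P v = v * (f - g v\<^bsup>2n\<^esup>)\<close>, the function \<open>\<eta>\<close> is the smooth square root of \<open>\<Lambda> u / u\<close>,
  that is, the turning point is \<open>sqrt u * \<eta> u\<close>. Oddness of \<open>P\<close> makes \<open>\<Lambda>\<close> and \<open>\<eta>\<close> available on the
  whole line.
\<close>

definition P :: "real \<Rightarrow> real" where "P v = f * v - g * v ^ (2 * n + 1)"
definition \<Lambda> :: "real \<Rightarrow> real" where "\<Lambda> = inv P"
definition \<eta> :: "real \<Rightarrow> real" where "\<eta> u = (f - g * \<Lambda> u ^ (2 * n)) powr (-1/2)"

lemma radicand_pos: "f - g * v ^ (2 * n) > 0"
proof -
  have "g * v ^ (2 * n) \<le> 0" using g_neg by (intro mult_nonpos_nonneg zero_le_even_power) auto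
  then show ?thesis using f_pos by simp
qed

lemma P_eq: "P v = v * (f - g * v ^ (2 * n))"
  by (simp add: P_def algebra_simps)

lemma smooth_P: "smooth P"
  unfolding P_def[abs_def] by (intro smooth_intros)

lemma deriv_P_pos: "deriv P v > 0"
proof -
  have "(P has_real_derivative f - g * (real (2 * n + 1) * v ^ (2 * n))) (at v)"
    unfolding P_def[abs_def] by (rule derivative_eq_intros refl | simp)+
  moreover have "g * (real (2 * n + 1) * v ^ (2 * n)) \<le> 0" 
    using g_neg by (intro mult_nonpos_nonneg mult_nonneg_nonneg zero_le_even_power) auto
  ultimately show ?thesis using f_pos by (simp add: DERIV_imp_deriv)
qed

lemma P_odd: "P (- v) = - P v"
  by (simp add: P_eq)

lemma P_\<Lambda>: "P (\<Lambda> u) = u"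
  unfolding \<Lambda>_def
proof (rule odd_unbounded_imp_surj[OF smooth_continuous[OF smooth_P] P_odd])
  fix y
  have "g * \<bar>y / f\<bar> ^ (2 * n + 1) \<le> 0"
    using g_neg by (intro mult_nonpos_nonneg) auto
  then have "P \<bar>y / f\<bar> \<ge> f * \<bar>y / f\<bar>" by (simp add: P_def)
  then show "\<exists>x. P x \<ge> y" using f_pos by (intro exI[of _ "\<bar>y / f\<bar>"]) (simp add: abs_divide)
qed

lemmas \<Lambda>_inverse = smooth_inverse_function[where F = P and G = \<Lambda>, OF smooth_P deriv_P_pos P_\<Lambda>]
lemmas smooth_\<Lambda> = \<Lambda>_inverse(1) and \<Lambda>_P = \<Lambda>_inverse(3) and \<Lambda>_mono = \<Lambda>_inverse(4)

lemma \<Lambda>_odd: "\<Lambda> (- u) = - \<Lambda> u"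
  by (metis P_\<Lambda> \<Lambda>_P P_odd)

lemma \<Lambda>_0: "\<Lambda> 0 = 0"
  using \<Lambda>_odd[of 0] by simp

lemma \<Lambda>_nonneg_iff: "\<Lambda> u \<ge> 0 \<longleftrightarrow> u \<ge> 0"
  using strict_mono_less_eq[OF \<Lambda>_mono, of 0 u] by (simp add: \<Lambda>_0)

lemma concave_on_\<Lambda>: "concave_on {0..} \<Lambda>"
proof (rule concave_on_inverse_function[where F = P and A = "{0..}"])
  have "convex_on {0..} (\<lambda>v. f * v + (- g) * v ^ (2 * n + 1))"
    using f_pos g_neg by (intro convex_on_add convex_on_cmul convex_power_odd) (auto simp: convex_on_ident)
  then show "convex_on {0..} P" by (simp add: P_def[abs_def])
qed (use \<Lambda>_inverse(2) P_\<Lambda> in \<open>auto simp: \<Lambda>_nonneg_iff\<close>)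

lemma \<eta>_pos: "\<eta> u > 0"
  using radicand_pos[of "\<Lambda> u"] by (simp add: \<eta>_def)

lemma smooth_\<eta>: "smooth \<eta>"
  unfolding \<eta>_def[abs_def] by (intro smooth_intros radicand_pos smooth_\<Lambda>)

lemma \<eta>_even: "\<eta> (- u) = \<eta> u"
  by (simp add: \<eta>_def \<Lambda>_odd)

lemma \<eta>_power2: "(\<eta> u)\<^sup>2 = inverse (f - g * \<Lambda> u ^ (2 * n))"
  using radicand_pos[of "\<Lambda> u"] by (simp add: \<eta>_def powr_half_sqrt powr_minus power_inverse)

lemma \<Lambda>_eq: "\<Lambda> u = u * (\<eta> u)\<^sup>2"
  using P_\<Lambda>[of u] radicand_pos[of "\<Lambda> u"] by (simp add: P_eq \<eta>_power2 field_simps)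

lemma \<eta>_antimono: "0 \<le> u \<Longrightarrow> u \<le> v \<Longrightarrow> \<eta> v \<le> \<eta> u"
proof -
  assume uv: "0 \<le> u" "u \<le> v"
  then have "\<Lambda> u \<le> \<Lambda> v" "0 \<le> \<Lambda> u" using strict_mono_less_eq[OF \<Lambda>_mono] by (auto simp: \<Lambda>_nonneg_iff)
  then have "- g * \<Lambda> u ^ (2 * n) \<le> - g * \<Lambda> v ^ (2 * n)"
    using g_neg by (intro mult_left_mono power_mono) auto
  then show ?thesis
    unfolding \<eta>_def by (intro powr_mono2') (use radicand_pos in auto)
qed

text \<open>
  \<open>h u = sqrt (u * \<Lambda> u)\<close> for \<open>u \<ge> 0\<close>. This function carries both the monotonicity and the
  concavity of the action, because \<open>c * (a * \<eta> (a c)) = h (a c)\<close>.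
\<close>

definition h :: "real \<Rightarrow> real" where "h u = u * \<eta> u"

lemma smooth_h: "smooth h"
  unfolding h_def[abs_def] by (intro smooth_mult smooth_ident smooth_\<eta>)

lemma h_eq: "h u = \<Lambda> u * sqrt (f - g * \<Lambda> u ^ (2 * n))"
proof -
  define s where "s = sqrt (f - g * \<Lambda> u ^ (2 * n))"
  have "s > 0" "s\<^sup>2 = f - g * \<Lambda> u ^ (2 * n)"
    using radicand_pos[of "\<Lambda> u"] by (auto simp: s_def)
  moreover from this have "u = \<Lambda> u * s\<^sup>2" using P_\<Lambda>[of u] by (simp add: P_eq)
  moreover have "\<eta> u = inverse s"
    using radicand_pos[of "\<Lambda> u"] by (simp add: s_def \<eta>_def powr_half_sqrt powr_minus)
  ultimately have "h u = \<Lambda> u * s\<^sup>2 * inverse s" by (simp add: h_def)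
  also have "\<dots> = \<Lambda> u * s" using \<open>s > 0\<close> by (simp add: power2_eq_square)
  finally show ?thesis by (simp add: s_def)
qed

text \<open>
  The chain rule through \<open>\<Lambda>\<close>: both \<open>\<Lambda>\<close> and \<open>v \<mapsto> v * sqrt (f - g v\<^bsup>2n\<^esup>)\<close> have positive derivatives.
\<close>

lemma deriv_h_pos: "deriv h u > 0"
proof -
  define Q where "Q v = v * sqrt (f - g * v ^ (2 * n))" for v
  let ?v = "\<Lambda> u"
  let ?r = "f - g * ?v ^ (2 * n)"
  have Q: "(Q has_real_derivative sqrt ?r + ?v * ((- g * (real (2 * n) * ?v ^ (2 * n - 1))) * (inverse (sqrt ?r) / 2))) (at ?v)"
    unfolding Q_def[abs_def] using radicand_pos[of ?v]
    by (auto intro!: derivative_eq_intros)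
  have "?v * ((- g * (real (2 * n) * ?v ^ (2 * n - 1))) * (inverse (sqrt ?r) / 2)) =
        (- g) * (real n * ?v ^ (2 * n)) * inverse (sqrt ?r)"
    by (cases n) simp_all
  moreover have "\<dots> \<ge> 0" using g_neg radicand_pos[of ?v]
    by (intro mult_nonneg_nonneg zero_le_even_power) auto
  moreover have "sqrt ?r > 0" using radicand_pos[of ?v] by simp
  moreover have "h = (\<lambda>u. Q (\<Lambda> u))" by (simp add: fun_eq_iff h_eq Q_def)
  ultimately have "deriv h u = (sqrt ?r + (- g) * (real n * ?v ^ (2 * n)) * inverse (sqrt ?r)) * deriv \<Lambda> u"
    using DERIV_imp_deriv[OF DERIV_chain2[OF Q smooth_DERIV_deriv[OF smooth_\<Lambda>]]] by simp
  moreover have "\<dots> > 0"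
    using \<open>sqrt ?r > 0\<close> \<Lambda>_inverse(5)[of u] \<open>(- g) * (real n * ?v ^ (2 * n)) * inverse (sqrt ?r) \<ge> 0\<close>
    by (intro mult_pos_pos add_pos_nonneg)
  ultimately show ?thesis by simp
qed

lemma concave_on_h: "concave_on {0..} h"
proof -
  have "concave_on {0..} (\<lambda>u. sqrt (u * \<Lambda> u))"
    using concave_on_\<Lambda> by (intro concave_on_sqrt_mult) (auto simp: concave_on_ident \<Lambda>_nonneg_iff)
  moreover have "sqrt (u * \<Lambda> u) = h u" if "u \<in> {0..}" for u
    using that \<eta>_pos[of u] by (simp add: \<Lambda>_eq h_def real_sqrt_mult mult.assoc[symmetric])
  ultimately show ?thesis by (auto simp: concave_on_iff)
qed

text \<open>
  \<open>I\<close> extends the action function from \<open>a \<ge> 0\<close> to the whole line (lemma \<open>action_eq_I\<close>).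
\<close>

definition J :: "real \<Rightarrow> real" where
  "J a = integral {-1..1} (\<lambda>t. sqrt (1 - t\<^sup>2) * \<eta> (a * (1 - t\<^sup>2)))"

definition I :: "real \<Rightarrow> real" where "I a = sqrt 8 / pi * (a * J a)"

lemma J_integrable: "(\<lambda>t. sqrt (1 - t\<^sup>2) * \<eta> (a * (1 - t\<^sup>2))) integrable_on {-1..1}"
  by (intro integrable_continuous_real continuous_intros
      continuous_on_compose2[OF smooth_continuous[OF smooth_\<eta>, of UNIV]]) auto

lemma smooth_J: "smooth J"
  unfolding J_def[abs_def] by (intro smooth_scaled_integral smooth_\<eta> continuous_intros)

lemma smooth_I: "smooth I"
  unfolding I_def[abs_def] by (intro smooth_mult smooth_const smooth_ident smooth_J)

text \<open>
  Differentiating \<open>a * \<eta> (a (1 - t\<^sup>2))\<close> in \<open>a\<close> gives \<open>deriv h (a (1 - t\<^sup>2))\<close>, which is positive.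
\<close>

lemma deriv_I_pos: "deriv I a > 0"
proof -
  note [continuous_intros] = 
      continuous_on_compose2[OF smooth_continuous[OF smooth_\<eta>, of UNIV]]
      continuous_on_compose2[OF smooth_continuous[OF smooth_deriv[OF smooth_\<eta>], of UNIV]]
      continuous_on_compose2[OF smooth_continuous[OF smooth_deriv[OF smooth_h], of UNIV]]
  let ?J' = "integral {-1..1} (\<lambda>t. sqrt (1 - t\<^sup>2) * (1 - t\<^sup>2) * deriv \<eta> (a * (1 - t\<^sup>2)))"
  have "(J has_real_derivative ?J') (at a)"
    unfolding J_def[abs_def] by (intro DERIV_scaled_integral smooth_\<eta> continuous_intros)
  then have "(I has_real_derivative sqrt 8 / pi * (J a + a * ?J')) (at a)"
    unfolding I_def[abs_def] by (auto intro!: derivative_eq_intros)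
  moreover have "J a + a * ?J' = integral {-1..1} (\<lambda>t. sqrt (1 - t\<^sup>2) * deriv h (a * (1 - t\<^sup>2)))"
  proof -
    have "deriv h u = \<eta> u + u * deriv \<eta> u" for u
      unfolding h_def[abs_def] using smooth_DERIV_deriv[OF smooth_\<eta>]
      by (intro DERIV_imp_deriv) (auto intro!: derivative_eq_intros)
    then have "sqrt (1 - t\<^sup>2) * deriv h (a * (1 - t\<^sup>2)) = sqrt (1 - t\<^sup>2) * \<eta> (a * (1 - t\<^sup>2)) +
        a * (sqrt (1 - t\<^sup>2) * (1 - t\<^sup>2) * deriv \<eta> (a * (1 - t\<^sup>2)))" for t
      by (simp add: algebra_simps)
    then show ?thesis unfolding J_def
      by (simp only:) (subst integral_add, auto intro!: J_integrable integrable_continuous_real continuous_intros)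
  qed
  moreover have "\<dots> > 0"
    using deriv_h_pos[of "a"]
    by (intro integral_pos_continuous[where t=0] continuous_intros)
       (auto intro!: mult_nonneg_nonneg less_imp_le[OF deriv_h_pos] simp: abs_square_le_1 abs_le_iff)
  ultimately show ?thesis by (simp add: DERIV_imp_deriv)
qed

lemma I_odd: "I (- a) = - I a"
  by (simp add: I_def J_def \<eta>_even)

text \<open>
  Since \<open>\<eta>\<close> decreases on the positive half line, replacing \<open>\<eta> (a (1 - t\<^sup>2))\<close> by \<open>\<eta> a\<close> bounds \<open>I a\<close>
  from below by a multiple of \<open>h a\<close>, hence by a multiple of \<open>\<Lambda> a\<close>.
\<close>

lemma I_unbounded: "\<exists>a. I a \<ge> y"
proof -
  define W where "W = integral {-1..1} (\<lambda>t::real. sqrt (1 - t\<^sup>2))"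
  have W: "W > 0" unfolding W_def
    by (intro integral_pos_continuous[where t=0] continuous_intros) (auto simp: abs_square_le_1 abs_le_iff)
  define C where "C = sqrt 8 / pi * sqrt f * W"
  have C: "C > 0" using W f_pos by (simp add: C_def)
  define v where "v = \<bar>y\<bar> / C"
  define a where "a = P v"
  have v: "v \<ge> 0" "\<Lambda> a = v" using C by (auto simp: v_def a_def \<Lambda>_P)
  then have a: "a \<ge> 0" using \<Lambda>_nonneg_iff by metis
  have "J a \<ge> integral {-1..1} (\<lambda>t. sqrt (1 - t\<^sup>2) * \<eta> a)"
    unfolding J_def
  proof (rule integral_le[OF _ J_integrable])
    fix t :: real assume "t \<in> {-1..1}"
    then have "t\<^sup>2 \<le> 1" by (simp add: abs_square_le_1 abs_le_iff)
    then have "\<eta> a \<le> \<eta> (a * (1 - t\<^sup>2))" "sqrt (1 - t\<^sup>2) \<ge> 0"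
      using a by (auto intro!: \<eta>_antimono simp: mult_left_le)
    then show "sqrt (1 - t\<^sup>2) * \<eta> a \<le> sqrt (1 - t\<^sup>2) * \<eta> (a * (1 - t\<^sup>2))"
      by (rule mult_left_mono)
  qed (intro integrable_continuous_real continuous_intros)
  then have "W * \<eta> a \<le> J a" by (simp add: W_def)
  then have "a * (W * \<eta> a) \<le> a * J a" using a by (rule mult_left_mono)
  moreover have "a * (W * \<eta> a) = W * h a" by (simp add: h_def)
  moreover have "W * (v * sqrt f) \<le> W * h a"
  proof -
    have "g * v ^ (2 * n) \<le> 0" using g_neg by (intro mult_nonpos_nonneg zero_le_even_power) auto
    then have "v * sqrt f \<le> h a" unfolding h_eq v(2) using v(1) by (intro mult_left_mono) auto
    then show ?thesis using W by simp
  qed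
  ultimately have "sqrt 8 / pi * (W * (v * sqrt f)) \<le> I a"
    unfolding I_def by (intro mult_left_mono) auto
  moreover have "sqrt 8 / pi * (W * (v * sqrt f)) = C * v" by (simp add: C_def)
  moreover have "C * v = \<bar>y\<bar>" using C by (simp add: v_def)
  ultimately have "\<bar>y\<bar> \<le> I a" by simp
  then show ?thesis by (intro exI[of _ a]) simp
qed

lemma I_inv: "I (inv I y) = y"
  by (rule odd_unbounded_imp_surj[OF smooth_continuous[OF smooth_I] I_odd I_unbounded])

lemmas I_inverse = smooth_inverse_function[where F = I and G = "inv I", OF smooth_I deriv_I_pos I_inv]

text \<open>
  The integrand is concave in \<open>a\<close> for each fixed \<open>t\<close>. At \<open>t = \<plusminus>1\<close>, where the factor \<open>1 - t\<^sup>2\<close>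
  vanishes, it is linear and cannot be rescaled to \<open>h\<close>.
\<close>

lemma concave_on_I: "concave_on {0..} I"
proof -
  have c: "concave_on {0..} (\<lambda>a. a * \<eta> (a * c))" if "c \<ge> 0" for c
    unfolding concave_on_iff
  proof (intro conjI ballI allI impI)
    fix x y u v :: real assume *: "x \<in> {0..}" "y \<in> {0..}" "0 \<le> u" "0 \<le> v" "u + v = 1"
    show "u * (x * \<eta> (x * c)) + v * (y * \<eta> (y * c)) \<le> (u *\<^sub>R x + v *\<^sub>R y) * \<eta> ((u *\<^sub>R x + v *\<^sub>R y) * c)"
    proof (cases "c = 0")
      case False
      have "u * h (x * c) + v * h (y * c) \<le> h (u *\<^sub>R (x * c) + v *\<^sub>R (y * c))"
        using concave_on_h * that unfolding concave_on_iff by auto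
      then have "c * (u * (x * \<eta> (x * c)) + v * (y * \<eta> (y * c))) \<le> c * ((u *\<^sub>R x + v *\<^sub>R y) * \<eta> ((u *\<^sub>R x + v *\<^sub>R y) * c))"
        by (simp add: h_def algebra_simps)
      then show ?thesis using False that by simp
    qed (simp add: algebra_simps)
  qed auto
  show ?thesis unfolding concave_on_iff
  proof (intro conjI ballI allI impI)
    fix x y u v :: real assume *: "x \<in> {0..}" "y \<in> {0..}" "0 \<le> u" "0 \<le> v" "u + v = 1"
    let ?w = "\<lambda>t::real. sqrt (1 - t\<^sup>2)" and ?c = "\<lambda>t::real. 1 - t\<^sup>2"
    have int: "(\<lambda>t. k * (?w t * \<eta> (a * ?c t))) integrable_on {-1..1}" for k a
      using integrable_on_mult_right[OF J_integrable] .
    have "u * (x * J x) + v * (y * J y) =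
       integral {-1..1} (\<lambda>t. u * x * (?w t * \<eta> (x * ?c t)) + v * y * (?w t * \<eta> (y * ?c t)))"
      unfolding J_def by (subst integral_add[OF int int]) (simp add: mult.assoc)
    also have "\<dots> \<le> integral {-1..1} (\<lambda>t. (u * x + v * y) * (?w t * \<eta> ((u * x + v * y) * ?c t)))"
    proof (rule integral_le[OF integrable_add[OF int int] int])
      fix t :: real assume "t \<in> {-1..1}"
      then have t: "?c t \<ge> 0" by (simp add: abs_square_le_1 abs_le_iff)
      have "u * (x * \<eta> (x * ?c t)) + v * (y * \<eta> (y * ?c t)) \<le> (u * x + v * y) * \<eta> ((u * x + v * y) * ?c t)"
        using c[OF t] * unfolding concave_on_iff by (metis real_scaleR_def)
      from mult_left_mono[OF this, of "?w t"]
      show "u * x * (?w t * \<eta> (x * ?c t)) + v * y * (?w t * \<eta> (y * ?c t))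
          \<le> (u * x + v * y) * (?w t * \<eta> ((u * x + v * y) * ?c t))"
        using t by (simp add: algebra_simps)
    qed
    also have "\<dots> = (u * x + v * y) * J (u * x + v * y)" by (simp add: J_def)
    finally have "sqrt 8 / pi * (u * (x * J x) + v * (y * J y)) \<le> sqrt 8 / pi * ((u * x + v * y) * J (u * x + v * y))"
      by (intro mult_left_mono) auto
    then show "u * I x + v * I y \<le> I (u *\<^sub>R x + v *\<^sub>R y)"
      by (simp add: I_def algebra_simps)
  qed auto
qed

lemma K_summand_less_iff: "K_summand f g n (x, y) < a \<longleftrightarrow> x\<^sup>2 < \<Lambda> (a - y\<^sup>2 / 8)"
proof -
  have "P (x\<^sup>2) = f * x\<^sup>2 - g * x ^ (4 * n + 2)"
    unfolding P_def by (simp only: power_mult[symmetric]) (simp add: algebra_simps)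
  then have "K_summand f g n (x, y) < a \<longleftrightarrow> P (x\<^sup>2) < P (\<Lambda> (a - y\<^sup>2 / 8))"
    by (auto simp: K_summand_def P_\<Lambda>)
  then show ?thesis using strict_mono_less[OF \<Lambda>_inverse(2)] by simp
qed

lemma emeasure_power2_less: "emeasure lborel {x::real. x\<^sup>2 < b} = ennreal (2 * sqrt (max 0 b))"
proof -
  have "x\<^sup>2 < b \<longleftrightarrow> x \<in> {- sqrt b<..<sqrt b}" for x :: real
    by (metis abs_less_iff greaterThanLessThan_iff minus_less_iff real_sqrt_abs real_sqrt_less_iff)
  then have "{x::real. x\<^sup>2 < b} = {- sqrt b<..<sqrt b}" by blast
  then show ?thesis by (cases "b \<ge> 0") (auto simp: max_def)
qed

text \<open>
  The slice at height \<open>y\<close> is an interval of half-width \<open>sqrt (\<Lambda> (a - y\<^sup>2/8))\<close>. The substitution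
  \<open>y = sqrt (8a) * t\<close> turns the argument of \<open>\<Lambda>\<close> into \<open>a (1 - t\<^sup>2)\<close> and the half-width into
  \<open>sqrt a * sqrt (1 - t\<^sup>2) * \<eta> (a (1 - t\<^sup>2))\<close>.
\<close>

lemma measure_K_summand_less:
  assumes "a \<ge> 0"
  shows "measure lborel {p. K_summand f g n p < a} = 2 * sqrt 8 * (a * J a)"
proof (cases "a = 0")
  case True
  then have "{p. K_summand f g n p < a} = {}"
    using K_summand_nonneg[OF f_pos g_neg, of n] by (auto simp: not_less[symmetric])
  then show ?thesis using True by (metis measure_empty mult_zero_left mult_zero_right)
next
  case False
  with assms have a: "a > 0" by simp
  have J_nonneg: "J a \<ge> 0" unfolding J_def
    by (intro integral_nonneg J_integrable mult_nonneg_nonneg less_imp_le[OF \<eta>_pos])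
       (auto simp: abs_square_le_1 abs_le_iff)
  let ?S = "{p. K_summand f g n p < a}"
  have "open ?S" by (intro open_Collect_less continuous_on_K_summand continuous_intros)
  then have S: "?S \<in> sets (lborel \<Otimes>\<^sub>M lborel)" by (metis borel_open lborel_prod sets_lborel)
  \<comment> \<open>the length of the slice; \<open>max\<close> makes it continuous where the slices become empty\<close>
  define G where "G y = ennreal (2 * sqrt (max 0 (\<Lambda> (a - y\<^sup>2 / 8))))" for y
  have G_meas: "G \<in> borel_measurable borel"
    unfolding G_def[abs_def]
    by (intro measurable_compose[OF borel_measurable_continuous_onI measurable_ennreal] continuous_intros
        continuous_on_compose2[OF smooth_continuous[OF smooth_\<Lambda>, of UNIV]]) auto
  have "emeasure lborel ?S = (\<integral>\<^sup>+y. emeasure lborel ((\<lambda>x. (x, y)) -` ?S) \<partial>lborel)"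
    using lborel_pair.emeasure_pair_measure_alt2[OF S] by (simp add: lborel_prod)
  also have "\<dots> = (\<integral>\<^sup>+y. G y \<partial>lborel)"
    by (simp add: vimage_def K_summand_less_iff emeasure_power2_less G_def)
  also have "\<dots> = ennreal (sqrt (8 * a)) * (\<integral>\<^sup>+t. G (0 + sqrt (8 * a) * t) \<partial>lborel)"
    using nn_integral_real_affine[OF G_meas, of "sqrt (8 * a)" 0] a by simp
  also have "(\<integral>\<^sup>+t. G (0 + sqrt (8 * a) * t) \<partial>lborel) =
     (\<integral>\<^sup>+t. ennreal (2 * sqrt a * (sqrt (1 - t\<^sup>2) * \<eta> (a * (1 - t\<^sup>2)))) * indicator {-1..1} t \<partial>lborel)"
  proof (rule nn_integral_cong)
    fix t :: real
    have arg: "a - (0 + sqrt (8 * a) * t)\<^sup>2 / 8 = a * (1 - t\<^sup>2)"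
      using a by (simp add: power_mult_distrib algebra_simps)
    have iff: "t \<in> {-1..1} \<longleftrightarrow> a * (1 - t\<^sup>2) \<ge> 0"
      using a by (auto simp: zero_le_mult_iff abs_square_le_1 abs_le_iff)
    show "G (0 + sqrt (8 * a) * t) =
        ennreal (2 * sqrt a * (sqrt (1 - t\<^sup>2) * \<eta> (a * (1 - t\<^sup>2)))) * indicator {-1..1} t"
    proof (cases "t \<in> {-1..1}")
      case True
      then have "max 0 (\<Lambda> (a * (1 - t\<^sup>2))) = a * (1 - t\<^sup>2) * (\<eta> (a * (1 - t\<^sup>2)))\<^sup>2"
        using iff \<Lambda>_nonneg_iff[of "a * (1 - t\<^sup>2)"] \<Lambda>_eq by simp
      then show ?thesis unfolding G_def arg
        using True \<eta>_pos[of "a * (1 - t\<^sup>2)"] by (simp add: real_sqrt_mult mult.assoc)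
    next
      case False
      then have "indicator {-1..1} t = (0::ennreal)" "max 0 (\<Lambda> (a * (1 - t\<^sup>2))) = 0"
        using iff \<Lambda>_nonneg_iff[of "a * (1 - t\<^sup>2)"] by auto
      then show ?thesis unfolding G_def arg by simp
    qed
  qed
  also have "\<dots> = ennreal (2 * sqrt a * J a)"
  proof (rule nn_integral_has_integral_lebesgue')
    show "((\<lambda>t. 2 * sqrt a * (sqrt (1 - t\<^sup>2) * \<eta> (a * (1 - t\<^sup>2)))) has_integral 2 * sqrt a * J a) {-1..1}"
      unfolding J_def by (intro has_integral_mult_right integrable_integral J_integrable)
  qed (use a \<eta>_pos in \<open>auto intro!: mult_nonneg_nonneg simp: abs_square_le_1 abs_le_iff less_imp_le\<close>)
  also have "ennreal (sqrt (8 * a)) * \<dots> = ennreal (2 * sqrt 8 * (a * J a))"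
    using a J_nonneg by (subst ennreal_mult[symmetric]) (auto simp: real_sqrt_mult)
  finally show ?thesis using a J_nonneg by (simp add: measure_def)
qed

lemma action_eq_I: "a \<ge> 0 \<Longrightarrow> action f g n a = I a"
  by (simp add: action_def inside_K_summand_level f_pos g_neg measure_K_summand_less I_def)

end

section \<open>The moment image\<close>

lemma K_eq_sum: "K f g n (z, w) = K_summand f g n (Re z, Re w) + K_summand f g n (Im z, Im w)"
  by (simp add: K_def K_summand_def cmod_power2 algebra_simps)

lemma moment_map_image:
  assumes "f > 0" "g < 0"
  shows "moment_map f g n ` {x. K f g n x = m} =
           {(action f g n a, action f g n (m - a)) | a. a \<in> {0..m}}"
proof (intro antisym subsetI)
  fix p assume "p \<in> moment_map f g n ` {x. K f g n x = m}"
  then obtain z w where zw: "K f g n (z, w) = m" "p = moment_map f g n (z, w)" by auto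
  let ?a = "K_summand f g n (Re z, Re w)"
  have "K_summand f g n (Im z, Im w) = m - ?a" using zw(1) by (simp add: K_eq_sum)
  moreover from this have "?a \<in> {0..m}"
    using K_summand_nonneg[OF assms, of n "(Re z, Re w)"] K_summand_nonneg[OF assms, of n "(Im z, Im w)"] by auto
  ultimately show "p \<in> {(action f g n a, action f g n (m - a)) | a. a \<in> {0..m}}"
    using zw(2) by (auto simp: moment_map_def)
next
  fix p assume "p \<in> {(action f g n a, action f g n (m - a)) | a. a \<in> {0..m}}"
  then obtain a where a: "0 \<le> a" "a \<le> m" "p = (action f g n a, action f g n (m - a))" by auto
  \<comment> \<open>over \<open>z = 0\<close> the two summands are \<open>w\<^sub>1\<^sup>2/8\<close> and \<open>w\<^sub>2\<^sup>2/8\<close>, so every splitting of \<open>m\<close> occurs\<close>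
  let ?w = "Complex (sqrt (8 * a)) (sqrt (8 * (m - a)))"
  have "K_summand f g n (0, sqrt (8 * b)) = b" if "b \<ge> 0" for b
    using that by (simp add: K_summand_def)
  then have "K_summand f g n (Re 0, Re ?w) = a" "K_summand f g n (Im 0, Im ?w) = m - a" using a by (simp_all del: right_diff_distrib_numeral)
  then have "K f g n (0, ?w) = m" "moment_map f g n (0, ?w) = p"
    unfolding K_eq_sum moment_map_def using a by simp_all
  then show "p \<in> moment_map f g n ` {x. K f g n x = m}" by (metis (mono_tags) image_eqI mem_Collect_eq)
qed

theorem theorem4:
  fixes m g f :: real and n :: nat
  assumes "m > 0" and "g < 0" and "n \<ge> 1" and "f > 0"
  shows "levi_civita_regularization (\<lambda>p q. H m g n p q + f) (\<lambda>x. K f g n x - m)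
       \<and> moment_map f g n ` {x. K f g n x = m} =
           {(action f g n a, action f g n (m - a)) | a. a \<in> {0..m}}
       \<and> bounds_convex_toric_domain (moment_map f g n) {x. K f g n x = m}"
proof (intro conjI)
  show "levi_civita_regularization (\<lambda>p q. H m g n p q + f) (\<lambda>x. K f g n x - m)"
    by (rule levi_civita_regularization_H)
  show image: "moment_map f g n ` {x. K f g n x = m} =
           {(action f g n a, action f g n (m - a)) | a. a \<in> {0..m}}"
    using assms by (intro moment_map_image)
  interpret decoupled_oscillator f g n using assms by unfold_locales
  have I_mono: "I x \<le> I y \<longleftrightarrow> x \<le> y" for x y using strict_mono_less_eq[OF I_inverse(2)] .
  have inv_mono: "inv I x \<le> inv I y \<longleftrightarrow> x \<le> y" for x y using strict_mono_less_eq[OF I_inverse(4)] .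
  have I_0: "I 0 = 0" using I_odd[of 0] by simp
  define A where "A = I m"
  define \<phi> where "\<phi> x = I (m - inv I x)" for x
  have range: "inv I x \<in> {0..m} \<longleftrightarrow> x \<in> {0..A}" for x
    using inv_mono[of "I 0" x] inv_mono[of x "I m"] unfolding I_inverse(3) by (simp add: I_0 A_def)
  show "bounds_convex_toric_domain (moment_map f g n) {x. K f g n x = m}"
    unfolding bounds_convex_toric_domain_def
  proof (intro exI[of _ A] exI[of _ \<phi>] conjI)
    show "A > 0" using strict_mono_less[OF I_inverse(2), of 0 m] assms by (simp add: A_def I_0)
    show "smooth_on {0..A} \<phi>"
      unfolding \<phi>_def[abs_def]
      using smooth_on_linear_argument[where l = "\<lambda>x. x", OF _ bounded_linear_ident]
        smooth_compose[OF smooth_I smooth_diff[OF smooth_const I_inverse(1)]] by blast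
    show "antimono_on {0..A} \<phi>"
      by (rule monotone_onI) (simp add: \<phi>_def I_mono inv_mono)
    show "\<phi> A = 0" by (simp add: \<phi>_def A_def I_inverse(3) I_0)
    show "concave_on {0..A} \<phi>"
      unfolding concave_on_iff
    proof (intro conjI ballI allI impI)
      fix x y u v :: real
      assume *: "x \<in> {0..A}" "y \<in> {0..A}" "0 \<le> u" "0 \<le> v" "u + v = 1"
      let ?x = "inv I x" and ?y = "inv I y"
      have xy: "?x \<in> {0..m}" "?y \<in> {0..m}" using * range by auto
      \<comment> \<open>the inverse of \<open>I\<close> is convex; applying \<open>I\<close>, increasing and concave, to \<open>m\<close> minus it\<close>
      have "u * x + v * y = u * I ?x + v * I ?y" by (simp add: I_inv)
      also have "\<dots> \<le> I (u * ?x + v * ?y)"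
        using concave_on_I xy * unfolding concave_on_iff by auto
      finally have "inv I (u * x + v * y) \<le> u * ?x + v * ?y"
        using inv_mono I_inverse(3) by metis
      moreover have "u * (m - ?x) + v * (m - ?y) = (u + v) * m - (u * ?x + v * ?y)"
        by (simp add: algebra_simps)
      ultimately have "u * (m - ?x) + v * (m - ?y) \<le> m - inv I (u * x + v * y)" using * by simp
      moreover have "u * I (m - ?x) + v * I (m - ?y) \<le> I (u * (m - ?x) + v * (m - ?y))"
        using concave_on_I xy * unfolding concave_on_iff by auto
      ultimately show "u * \<phi> x + v * \<phi> y \<le> \<phi> (u *\<^sub>R x + v *\<^sub>R y)"
        unfolding \<phi>_def real_scaleR_def using I_mono order_trans by blast
    qed auto
    have "{(action f g n a, action f g n (m - a)) | a. a \<in> {0..m}} = {(I a, I (m - a)) | a. a \<in> {0..m}}"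
      unfolding Setcompr_eq_image by (intro image_cong refl) (simp add: action_eq_I)
    also have "\<dots> = {(x, \<phi> x) | x. x \<in> {0..A}}"
    proof (intro antisym subsetI)
      fix p assume "p \<in> {(I a, I (m - a)) | a. a \<in> {0..m}}"
      then obtain a where "a \<in> {0..m}" "p = (I a, I (m - a))" by blast
      then show "p \<in> {(x, \<phi> x) | x. x \<in> {0..A}}"
        using range[of "I a"] by (auto simp: \<phi>_def I_inverse(3))
    next
      fix p assume "p \<in> {(x, \<phi> x) | x. x \<in> {0..A}}"
      then obtain x where "x \<in> {0..A}" "p = (x, \<phi> x)" by blast
      then show "p \<in> {(I a, I (m - a)) | a. a \<in> {0..m}}"
        using range[of x] I_inv[of x] by (auto simp: \<phi>_def intro!: exI[of _ "inv I x"])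
    qed
    finally show "moment_map f g n ` {x. K f g n x = m} = {(x, \<phi> x) | x. x \<in> {0..A}}"
      unfolding image .
  qed
qed

end
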